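(* Let $Q\in M_d(\mathbb{C})$ be a strictly positive diagonal matrix. Then there is an isomorphism of complex vector spaces $$H^2(U_Q^+)\cong\Delta(Z^2(U_Q^+)),$$ where $\Delta:Z^2(U_Q^+)\to M_d(\mathbb{C})$ is the defect map.
   Context: Write $Q_j:=Q_{jj}$. $A_u(Q)$ denotes the universal complex unital $^*$-algebra generated by $u_{jk}$ ($j,k=1,\dots,d$) such that, with $u=(u_{jk})$, $\bar u=(u_{jk}^* )_{j,k}$, $u^t=(u_{kj})_{j,k}$, one has $uu^*=I=u^*u$ and $u^tQ\bar uQ^{-1}=I=Q\bar uQ^{-1}u^t$. Its distinguished character is the unital $^*$-homomorphism $\epsilon$ with $\epsilon(u_{jk})=\delta_{jk}$. With $A=A_u(Q)$: $Z^2(U_Q^+)$ is the space of linear maps $c:A\otimes A\to\mathbb{C}$ with $\epsilon(x)c(y\otimes z)-c(xy\otimes z)+c(x\otimes yz)-c(x\otimes y)\epsilon(z)=0$ for all $x,y,z\in A$; $B^2(U_Q^+)$ is the subspace of maps $\partial\psi$, $(\partial\psi)(x\otimes y)=\epsilon(x)\psi(y)-\psi(xy)+\psi(x)\epsilon(y)$, with $\psi:A\to\mathbb{C}$ linear; $H^2(U_Q^+)=Z^2(U_Q^+)/B^2(U_Q^+)$. The defect map sends $c\in Z^2(U_Q^+)$ to the matrix $\Delta(c)\in M_d(\mathbb{C})$ with $\Delta(c)_{jk}=A_{jk}-B_{kj}$ if $Q_j=Q_k$ and $\Delta(c)_{jk}=0$ if $Q_j\neq Q_k$, where $$A_{jk}=\sum_{p=1}^d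 c(u_{pj}^*\otimes u_{pk}),\qquad B_{jk}=\sum_{p=1}^d\frac{Q_j}{Q_p}c(u_{jp}^*\otimes u_{kp}).$$ *)

theory Defs
  imports
    "HOL-Analysis.Analysis"
    "HOL-Algebra.QuotRing"
    "HOL-Algebra.Module"
    "HOL-Library.Poly_Mapping"
    "HOL-Library.Complex_Order"
begin

section \<open>The free unital *-algebra on a matrix of generators\<close>

text \<open>Words form a monoid under concatenation, so that finitely supported functions on words
  form the free algebra, with convolution as multiplication.\<close>

instantiation list :: (type) monoid_add
begin
definition zero_list :: "'a list" where "zero_list = []"
definition plus_list :: "'a list \<Rightarrow> 'a list \<Rightarrow> 'a list" where "plus_list = (@)"
instance by standard (simp_all add: zero_list_def plus_list_def)
end

text \<open>\<open>Gen j k\<close> and \<open>Gen_star j k\<close> stand for the letters $u_{jk}$ and $u_{jk}^*$.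
  The size of the matrices is the cardinality of the finite index type \<open>'d\<close>.\<close>

datatype 'd letter = Gen 'd 'd | Gen_star 'd 'd

type_synonym 'd free_alg = "'d letter list \<Rightarrow>\<^sub>0 complex"

fun letter_star :: "'d letter \<Rightarrow> 'd letter" where
  "letter_star (Gen j k) = Gen_star j k"
| "letter_star (Gen_star j k) = Gen j k"

definition free_const :: "complex \<Rightarrow> 'd free_alg" where
  "free_const a = Poly_Mapping.single 0 a"

definition free_letter :: "'d letter \<Rightarrow> 'd free_alg" where
  "free_letter l = Poly_Mapping.single [l] 1"

definition free_star :: "'d free_alg \<Rightarrow> 'd free_alg" where
  "free_star f =
    (\<Sum>w \<in> Poly_Mapping.keys f.
      Poly_Mapping.single (rev (map letter_star w)) (cnj (Poly_Mapping.lookup f w)))"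

definition Free :: "(complex, 'd free_alg) module" where
  "Free = \<lparr>carrier = UNIV, mult = (*), one = 1, zero = 0, add = (+),
           smult = (\<lambda>a f. free_const a * f)\<rparr>"


section \<open>Quotients and isomorphisms of complex vector spaces\<close>

text \<open>Complex vector spaces and algebras are \<^type>\<open>module\<close> records with scalars \<^typ>\<open>complex\<close>;
  for plain vector spaces the fields \<open>mult\<close> and \<open>one\<close> are irrelevant.
  On cosets of a subspace \<open>W\<close> the union in \<open>smult\<close> is the single coset $W + a x$; taking
  it instead of $\{a x \mid x \in X\}$ is needed for $a = 0$.\<close>

definition quot_space :: "(complex, 'v) module \<Rightarrow> 'v set \<Rightarrow> (complex, 'v set) module" where
  "quot_space V W = ring.extend (V Quot W)
     (module.fields (\<lambda>a X. \<Union>x\<in>X. W +>\<^bsub>V\<^esub> (a \<odot>\<^bsub>V\<^esub> x)))"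

definition vs_iso :: "(complex, 'v) module \<Rightarrow> (complex, 'w) module \<Rightarrow> ('v \<Rightarrow> 'w) set" where
  "vs_iso V W =
    {\<phi>. bij_betw \<phi> (carrier V) (carrier W)
      \<and> (\<forall>x\<in>carrier V. \<forall>y\<in>carrier V. \<phi> (x \<oplus>\<^bsub>V\<^esub> y) = \<phi> x \<oplus>\<^bsub>W\<^esub> \<phi> y)
      \<and> (\<forall>a. \<forall>x\<in>carrier V. \<phi> (a \<odot>\<^bsub>V\<^esub> x) = a \<odot>\<^bsub>W\<^esub> \<phi> x)}"

text \<open>Functions on a carrier are represented by functions that vanish outside of it.\<close>

definition linear_functionals :: "(complex, 'v) module \<Rightarrow> ('v \<Rightarrow> complex) set" where
  "linear_functionals V =
    {\<psi>. (\<forall>x\<in>carrier V. \<forall>y\<in>carrier V. \<psi> (x \<oplus>\<^bsub>V\<^esub> y) = \<psi> x + \<psi> y)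
      \<and> (\<forall>a. \<forall>x\<in>carrier V. \<psi> (a \<odot>\<^bsub>V\<^esub> x) = a * \<psi> x)
      \<and> (\<forall>x. x \<notin> carrier V \<longrightarrow> \<psi> x = 0)}"

text \<open>Linear maps $V \otimes V \to \mathbb{C}$, written as bilinear maps in two arguments.\<close>

definition bilinear_functionals :: "(complex, 'v) module \<Rightarrow> ('v \<Rightarrow> 'v \<Rightarrow> complex) set" where
  "bilinear_functionals V =
    {c. (\<forall>x. (\<lambda>y. c x y) \<in> linear_functionals V) \<and> (\<forall>y. (\<lambda>x. c x y) \<in> linear_functionals V)}"


section \<open>The algebra $A_u(Q)$\<close>

definition const_mat :: "complex^'d^'d \<Rightarrow> 'd free_alg^'d^'d" where
  "const_mat M = (\<chi> j k. free_const (M $ j $ k))"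

definition u_mat :: "'d free_alg^'d^'d" where
  "u_mat = (\<chi> j k. free_letter (Gen j k))"

definition u_bar :: "'d free_alg^'d^'d" where
  "u_bar = (\<chi> j k. free_star (u_mat $ j $ k))"

text \<open>The four matrix relations, each as a matrix which is to become zero; the adjoint $u^*$
  is \<open>transpose u_bar\<close>.\<close>

definition relation_mats :: "complex^'d^'d \<Rightarrow> ('d free_alg^'d^'d) set" where
  "relation_mats Q =
    {u_mat ** transpose u_bar - mat 1,
     transpose u_bar ** u_mat - mat 1,
     transpose u_mat ** const_mat Q ** u_bar ** const_mat (matrix_inv Q) - mat 1,
     const_mat Q ** u_bar ** const_mat (matrix_inv Q) ** transpose u_mat - mat 1}"

definition rel_ideal :: "complex^'d^'d \<Rightarrow> 'd free_alg set" where
  "rel_ideal Q =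
    \<Inter>{I. ideal I Free \<and> free_star ` I \<subseteq> I \<and> (\<forall>R\<in>relation_mats Q. \<forall>j k. R $ j $ k \<in> I)}"

definition Au :: "complex^'d^'d \<Rightarrow> (complex, 'd free_alg set) module" where
  "Au Q = quot_space Free (rel_ideal Q)"

definition Au_star :: "'d free_alg set \<Rightarrow> 'd free_alg set" where
  "Au_star X = free_star ` X"

definition Au_gen :: "complex^'d^'d \<Rightarrow> 'd \<Rightarrow> 'd \<Rightarrow> 'd free_alg set" where
  "Au_gen Q j k = rel_ideal Q +>\<^bsub>Free\<^esub> (u_mat $ j $ k)"

definition is_distinguished_character ::
    "complex^'d^'d \<Rightarrow> ('d free_alg set \<Rightarrow> complex) \<Rightarrow> bool" where
  "is_distinguished_character Q e \<longleftrightarrow>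
     e \<in> linear_functionals (Au Q)
     \<and> (\<forall>x\<in>carrier (Au Q). \<forall>y\<in>carrier (Au Q). e (x \<otimes>\<^bsub>Au Q\<^esub> y) = e x * e y)
     \<and> e \<one>\<^bsub>Au Q\<^esub> = 1
     \<and> (\<forall>x\<in>carrier (Au Q). e (Au_star x) = cnj (e x))
     \<and> (\<forall>j k. e (Au_gen Q j k) = (if j = k then 1 else 0))"

definition counit :: "complex^'d^'d \<Rightarrow> 'd free_alg set \<Rightarrow> complex" where
  "counit Q = (THE e. is_distinguished_character Q e)"


subsection \<open>Existence and uniqueness of the distinguished character\<close>

lemma free_alg_induct [case_names single add]:
  fixes f :: "'d free_alg"
  assumes "\<And>w a. P (Poly_Mapping.single w a)" and "\<And>f g. P f \<Longrightarrow> P g \<Longrightarrow> P (f + g)"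
  shows "P f"
proof (induction f rule: update_induct)
  case const
  show ?case using assms(1)[of 0 0] by simp
next
  case (update f w a)
  have "Poly_Mapping.update w a f = f + Poly_Mapping.single w a"
    using update.hyps(1)
    by (intro poly_mapping_eqI)
      (auto simp: lookup_update lookup_add lookup_single when_def in_keys_iff)
  then show ?case using assms(2)[OF update.IH assms(1)] by simp
qed

lemma free_sum_keys:
  fixes F :: "'d letter list \<Rightarrow> complex \<Rightarrow> 'b::comm_monoid_add"
  assumes F0: "\<And>w. F w 0 = 0" and Fadd: "\<And>w a b. F w (a + b) = F w a + F w b"
  defines "S \<equiv> \<lambda>f. \<Sum>w\<in>Poly_Mapping.keys f. F w (Poly_Mapping.lookup f w)"
  shows "S (f + g) = S f + S g" and "S (Poly_Mapping.single w a) = F w a" and "S 0 = 0"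
proof -
  have ext: "S h = (\<Sum>w\<in>T. F w (Poly_Mapping.lookup h w))"
    if "finite T" "Poly_Mapping.keys h \<subseteq> T" for h T
    unfolding S_def using that by (intro sum.mono_neutral_left) (auto simp: in_keys_iff F0)
  let ?T = "Poly_Mapping.keys f \<union> Poly_Mapping.keys g"
  have "Poly_Mapping.keys (f + g) \<subseteq> ?T" by (rule Poly_Mapping.keys_add)
  then show "S (f + g) = S f + S g"
    by (simp add: ext[of ?T] lookup_add Fadd sum.distrib)
  show "S (Poly_Mapping.single w a) = F w a"
    by (subst ext[of "{w}"]) auto
  show "S 0 = 0" by (simp add: S_def)
qed

lemma free_star_simps:
  "free_star (f + g) = free_star f + free_star g"
  "free_star (Poly_Mapping.single w a) = Poly_Mapping.single (rev (map letter_star w)) (cnj a)"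
  unfolding free_star_def
  by (rule free_sum_keys[where F="\<lambda>w a. Poly_Mapping.single (rev (map letter_star w)) (cnj a)"];
      simp add: single_add)+

fun letter_eval :: "'d letter \<Rightarrow> complex" where
  "letter_eval (Gen j k) = (if j = k then 1 else 0)"
| "letter_eval (Gen_star j k) = (if j = k then 1 else 0)"

definition free_eval :: "'d free_alg \<Rightarrow> complex" where
  "free_eval f =
    (\<Sum>w\<in>Poly_Mapping.keys f. Poly_Mapping.lookup f w * prod_list (map letter_eval w))"

lemma free_eval_add: "free_eval (f + g) = free_eval f + free_eval g"
  and free_eval_single: "free_eval (Poly_Mapping.single w a) = a * prod_list (map letter_eval w)"
  and free_eval_0: "free_eval 0 = 0"
  unfolding free_eval_def
  by (rule free_sum_keys[where F="\<lambda>w a. a * prod_list (map letter_eval w)"];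
      simp add: algebra_simps)+

lemma free_eval_const: "free_eval (free_const a) = a"
  by (simp add: free_const_def free_eval_single zero_list_def)

lemma free_eval_1: "free_eval 1 = 1"
  using free_eval_const[of 1] by (simp add: free_const_def)

lemma free_eval_minus: "free_eval (- f) = - free_eval f"
  using free_eval_add[of f "- f"] by (simp add: free_eval_0 eq_neg_iff_add_eq_0 add.commute)

lemma free_eval_mult: "free_eval (f * g) = free_eval f * free_eval g"
proof (induction f rule: free_alg_induct)
  case (single w a)
  show ?case
    by (induction g rule: free_alg_induct)
      (simp_all add: mult_single free_eval_single plus_list_def free_eval_add algebra_simps)
qed (simp add: free_eval_add algebra_simps)

lemma free_eval_star: "free_eval (free_star f) = cnj (free_eval f)"
proof (induction f rule: free_alg_induct)
  case (single w a)
  have l: "letter_eval (letter_star l) = cnj (letter_eval l)" for l :: "'d letter"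
    by (cases l) auto
  have "prod_list (map letter_eval (rev (map letter_star w))) = cnj (prod_list (map letter_eval w))"
    by (induction w) (simp_all add: l)
  then show ?case by (simp add: free_star_simps free_eval_single)
qed (simp add: free_star_simps free_eval_add)

lemma ring_Free: "ring (Free :: (complex, 'd free_alg) module)"
proof -
  have "\<exists>g. g + f = 0 \<and> f + g = 0" for f :: "'d free_alg"
    by (rule exI[of _ "- f"]) simp
  then show ?thesis
    by unfold_locales (auto simp: Free_def Units_def algebra_simps)
qed

lemma ideal_rel_ideal: "ideal (rel_ideal Q) Free"
  unfolding rel_ideal_def
proof (rule ring.i_Intersect[OF ring_Free])
  have "ideal (UNIV :: 'd free_alg set) Free"
    using ring.oneideal[OF ring_Free] by (simp add: Free_def)
  then show "{I. ideal I Free \<and> free_star ` I \<subseteq> I \<and>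
      (\<forall>R\<in>relation_mats Q. \<forall>j k. R $ j $ k \<in> I)} \<noteq> {}"
    by blast
qed auto

lemma free_eval_rel_ideal:
  fixes Q :: "complex^'d^'d"
  assumes Q: "invertible Q" and f: "f \<in> rel_ideal Q"
  shows "free_eval f = 0"
proof -
  let ?K = "{f :: 'd free_alg. free_eval f = 0}"
  define ev where "ev = (\<lambda>M :: 'd free_alg^'d^'d. \<chi> j k. free_eval (M $ j $ k))"
  interpret ring "Free :: (complex, 'd free_alg) module" by (rule ring_Free)
  have sum: "free_eval (\<Sum>p\<in>S. F p) = (\<Sum>p\<in>S. free_eval (F p))" for F :: "'d \<Rightarrow> 'd free_alg" and S
    by (induction S rule: infinite_finite_induct) (simp_all add: free_eval_0 free_eval_add)
  have mm: "ev (M ** N) = ev M ** ev N" for M N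
    by (simp add: ev_def matrix_matrix_mult_def sum free_eval_mult vec_eq_iff)
  have sub: "ev (M - N) = ev M - ev N" for M N
    by (simp add: ev_def vec_eq_iff diff_conv_add_uminus free_eval_add free_eval_minus
        del: add_uminus_conv_diff)
  have one: "ev (mat 1) = mat 1"
    by (simp add: ev_def vec_eq_iff mat_def free_eval_0 free_eval_1)
  have u: "ev u_mat = mat 1" "ev (transpose u_mat) = mat 1"
      "ev u_bar = mat 1" "ev (transpose u_bar) = mat 1"
    by (auto simp: ev_def vec_eq_iff mat_def transpose_def u_mat_def u_bar_def free_eval_star
        free_letter_def free_eval_single)
  have c: "ev (const_mat M) = M" for M
    by (simp add: ev_def vec_eq_iff const_mat_def free_eval_const)
  have inv: "Q ** matrix_inv Q = mat 1"
    using someI_ex[OF Q[unfolded invertible_def]] unfolding matrix_inv_def by blast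
  have "ev R = 0" if "R \<in> relation_mats Q" for R
    using that unfolding relation_mats_def
    by (auto simp: mm sub one u c inv simp flip: matrix_mul_assoc)
  then have rel: "\<forall>R\<in>relation_mats Q. \<forall>j k. R $ j $ k \<in> ?K"
    by (simp add: ev_def vec_eq_iff)
  have "subgroup ?K (add_monoid Free)"
  proof (rule add.subgroupI)
    fix a assume "a \<in> ?K"
    then have "free_eval a = 0" by simp
    moreover have "\<ominus>\<^bsub>Free\<^esub> a = - a"
      by (rule minus_equality) (simp_all add: Free_def)
    ultimately show "\<ominus>\<^bsub>Free\<^esub> a \<in> ?K" by (simp add: free_eval_minus)
  qed (auto simp: Free_def free_eval_add intro: exI[of _ 0] free_eval_0)
  then have "ideal ?K Free"
    by (intro idealI ring_Free) (auto simp: Free_def free_eval_mult)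
  moreover have "free_star ` ?K \<subseteq> ?K" by (auto simp: free_eval_star)
  ultimately have "rel_ideal Q \<subseteq> ?K" using rel unfolding rel_ideal_def by blast
  then show ?thesis using f by blast
qed

abbreviation Au_class :: "complex^'d^'d \<Rightarrow> 'd free_alg \<Rightarrow> 'd free_alg set" where
  "Au_class Q f \<equiv> rel_ideal Q +>\<^bsub>Free\<^esub> f"

lemma Au_simps:
  "carrier (Au Q) = range (Au_class Q)"
  "\<one>\<^bsub>Au Q\<^esub> = Au_class Q 1"
  "Au_class Q f \<oplus>\<^bsub>Au Q\<^esub> Au_class Q g = Au_class Q (f + g)"
  "Au_class Q f \<otimes>\<^bsub>Au Q\<^esub> Au_class Q g = Au_class Q (f * g)"
  "a \<odot>\<^bsub>Au Q\<^esub> Au_class Q f = Au_class Q (free_const a * f)"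
  "Au_star (Au_class Q f) = Au_class Q (free_star f)"
  "f \<in> Au_class Q f"
proof -
  interpret ideal "rel_ideal Q" Free by (rule ideal_rel_ideal)
  have carr: "carrier Free = UNIV" by (simp add: Free_def)
  have ops: "x \<oplus>\<^bsub>Free\<^esub> y = x + y" "x \<otimes>\<^bsub>Free\<^esub> y = x * y" "\<one>\<^bsub>Free\<^esub> = 1"
    "b \<odot>\<^bsub>Free\<^esub> x = free_const b * x" for x y :: "'a free_alg" and b
    by (simp_all add: Free_def)
  note defs = Au_def quot_space_def ring.extend_def FactRing_def module.fields_def
    monoid.extend_def
  have mem: "h \<in> Au_class Q g \<longleftrightarrow> (\<exists>i\<in>rel_ideal Q. h = i + g)" for h g
    by (auto simp: a_r_coset_def' ops)
  show self: "g \<in> Au_class Q g" for g using a_rcos_self[of g] by (simp add: carr)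
  show "carrier (Au Q) = range (Au_class Q)"
    by (auto simp: defs A_RCOSETS_def' carr)
  show "\<one>\<^bsub>Au Q\<^esub> = Au_class Q 1" by (simp add: defs ops)
  show "Au_class Q f \<oplus>\<^bsub>Au Q\<^esub> Au_class Q g = Au_class Q (f + g)"
    using a_rcos_sum[of f g] by (simp add: defs ops carr)
  show "Au_class Q f \<otimes>\<^bsub>Au Q\<^esub> Au_class Q g = Au_class Q (f * g)"
    using rcoset_mult_add[of f g] by (simp add: defs ops carr)
  have scale: "Au_class Q (free_const a * x) = Au_class Q (free_const a * f)"
    if x: "x \<in> Au_class Q f" for x
  proof -
    obtain i where i: "i \<in> rel_ideal Q" "x = i + f"
      using x unfolding mem by (elim bexE)
    have "free_const a * i \<in> rel_ideal Q"
      using I_l_closed[OF i(1), of "free_const a"] by (simp add: carr ops)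
    moreover have "free_const a * x = free_const a * i + free_const a * f"
      by (simp add: i(2) distrib_left)
    ultimately have "free_const a * x \<in> Au_class Q (free_const a * f)"
      unfolding mem by (rule bexI[rotated])
    then show ?thesis
      by (intro a_repr_independence'[symmetric]) (simp_all add: carr)
  qed
  have "a \<odot>\<^bsub>Au Q\<^esub> Au_class Q f = (\<Union>x\<in>Au_class Q f. Au_class Q (free_const a * x))"
    by (simp add: defs ops)
  also have "\<dots> = (\<Union>x\<in>Au_class Q f. Au_class Q (free_const a * f))"
    by (rule SUP_cong[OF refl scale])
  also have "\<dots> = Au_class Q (free_const a * f)"
    using self[of f] by (subst UN_constant) auto
  finally show "a \<odot>\<^bsub>Au Q\<^esub> Au_class Q f = Au_class Q (free_const a * f)" .
  have invol: "free_star (free_star h) = h" for h :: "'a free_alg"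
  proof (induction h rule: free_alg_induct)
    case (single w a)
    have "letter_star (letter_star l) = l" for l :: "'a letter" by (cases l) auto
    then show ?case by (simp add: free_star_simps rev_map o_def)
  qed (simp add: free_star_simps)
  have closed: "free_star i \<in> rel_ideal Q" if "i \<in> rel_ideal Q" for i
    using that unfolding rel_ideal_def by blast
  show "Au_star (Au_class Q f) = Au_class Q (free_star f)"
  proof (intro equalityI subsetI)
    fix h assume "h \<in> Au_class Q (free_star f)"
    then obtain i where i: "i \<in> rel_ideal Q" "h = i + free_star f"
      unfolding mem by (elim bexE)
    have "h = free_star (free_star i + f)"
      by (simp add: i(2) free_star_simps invol)
    moreover have "free_star i + f \<in> Au_class Q f"
      unfolding mem using closed[OF i(1)] by (intro bexI[of _ "free_star i"] refl)
    ultimately show "h \<in> Au_star (Au_class Q f)" unfolding Au_star_def by blast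
  next
    fix h assume "h \<in> Au_star (Au_class Q f)"
    then obtain x where x: "x \<in> Au_class Q f" "h = free_star x"
      unfolding Au_star_def by (elim imageE)
    from x(1) obtain i where "i \<in> rel_ideal Q" "x = i + f"
      unfolding mem by (elim bexE)
    then show "h \<in> Au_class Q (free_star f)"
      unfolding mem by (intro bexI[of _ "free_star i"] closed) (simp_all add: x(2) free_star_simps)
  qed
qed

theorem ex1_distinguished_character:
  fixes Q :: "complex^'d^'d"
  assumes "invertible Q"
  shows "\<exists>!e. is_distinguished_character Q e"
proof -
  define e where "e = (\<lambda>X. if X \<in> carrier (Au Q) then free_eval (SOME f. f \<in> X) else 0)"
  have e: "e (Au_class Q f) = free_eval f" for f
  proof -
    interpret ideal "rel_ideal Q" Free by (rule ideal_rel_ideal)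
    have "(SOME g. g \<in> Au_class Q f) \<in> Au_class Q f" using Au_simps(7) by (rule someI)
    then obtain i where "i \<in> rel_ideal Q" "(SOME g. g \<in> Au_class Q f) = i + f"
      by (auto simp: a_r_coset_def' Free_def)
    then show ?thesis
      using free_eval_rel_ideal[OF assms] by (simp add: e_def Au_simps free_eval_add)
  qed
  show ?thesis
  proof (rule ex1I[of _ e])
    show "is_distinguished_character Q e"
      unfolding is_distinguished_character_def linear_functionals_def
      by (auto simp: Au_simps e free_eval_add free_eval_mult free_eval_const free_eval_1 free_eval_star
          Au_gen_def u_mat_def free_letter_def free_eval_single)
         (auto simp: e_def Au_simps)
  next
    fix e' assume e': "is_distinguished_character Q e'"
    have add: "e' (Au_class Q (f + g)) = e' (Au_class Q f) + e' (Au_class Q g)"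
      and mult: "e' (Au_class Q (f * g)) = e' (Au_class Q f) * e' (Au_class Q g)"
      and one: "e' (Au_class Q 1) = 1"
      and scale: "e' (Au_class Q (free_const a * f)) = a * e' (Au_class Q f)"
      and star: "e' (Au_class Q (free_star f)) = cnj (e' (Au_class Q f))"
      and gen: "e' (Au_class Q (free_letter (Gen j k))) = (if j = k then 1 else 0)"
      and out: "X \<notin> carrier (Au Q) \<Longrightarrow> e' X = 0" for f g a j k X
      using e' unfolding is_distinguished_character_def linear_functionals_def
      by (auto simp flip: Au_simps simp: Au_gen_def u_mat_def) (auto simp: Au_simps)
    have letter: "e' (Au_class Q (free_letter l)) = letter_eval l" for l
    proof (cases l)
      case (Gen_star j k)
      have "free_letter l = free_star (free_letter (Gen j k))"
        by (simp add: free_letter_def free_star_simps Gen_star)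
      then show ?thesis using star gen Gen_star by simp
    qed (simp add: gen)
    have word: "e' (Au_class Q (Poly_Mapping.single w 1)) = prod_list (map letter_eval w)" for w
    proof (induction w)
      case Nil
      have "Poly_Mapping.single [] 1 = (1 :: 'd free_alg)" by (simp flip: zero_list_def)
      then show ?case using one by simp
    next
      case (Cons l w)
      have "Poly_Mapping.single (l # w) 1 = free_letter l * (Poly_Mapping.single w 1 :: 'd free_alg)"
        by (simp add: free_letter_def mult_single plus_list_def)
      then show ?case using mult letter Cons by simp
    qed
    have "e' (Au_class Q f) = free_eval f" for f
    proof (induction f rule: free_alg_induct)
      case (single w a)
      have "Poly_Mapping.single w a = free_const a * Poly_Mapping.single w 1"
        by (simp add: free_const_def mult_single)
      then show ?case using scale word free_eval_single by metis
    qed (simp add: add free_eval_add)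
    then show "e' = e"
      using e out by (intro ext) (metis Au_simps(1) e_def rangeE)
  qed
qed


section \<open>Second cohomology and the defect map\<close>

definition Z2 :: "complex^'d^'d \<Rightarrow> ('d free_alg set \<Rightarrow> 'd free_alg set \<Rightarrow> complex) set" where
  "Z2 Q =
    {c \<in> bilinear_functionals (Au Q).
      \<forall>x\<in>carrier (Au Q). \<forall>y\<in>carrier (Au Q). \<forall>z\<in>carrier (Au Q).
        counit Q x * c y z - c (x \<otimes>\<^bsub>Au Q\<^esub> y) z + c x (y \<otimes>\<^bsub>Au Q\<^esub> z) - c x y * counit Q z = 0}"

definition coboundary ::
    "complex^'d^'d \<Rightarrow> ('d free_alg set \<Rightarrow> complex) \<Rightarrow> 'd free_alg set \<Rightarrow> 'd free_alg set \<Rightarrow> complex"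
  where
  "coboundary Q \<psi> x y =
    (if x \<in> carrier (Au Q) \<and> y \<in> carrier (Au Q)
     then counit Q x * \<psi> y - \<psi> (x \<otimes>\<^bsub>Au Q\<^esub> y) + \<psi> x * counit Q y else 0)"

definition B2 :: "complex^'d^'d \<Rightarrow> ('d free_alg set \<Rightarrow> 'd free_alg set \<Rightarrow> complex) set" where
  "B2 Q = coboundary Q ` linear_functionals (Au Q)"

definition Z2_space ::
    "complex^'d^'d \<Rightarrow> (complex, 'd free_alg set \<Rightarrow> 'd free_alg set \<Rightarrow> complex) module" where
  "Z2_space Q = \<lparr>carrier = Z2 Q, mult = undefined, one = undefined,
     zero = (\<lambda>x y. 0), add = (\<lambda>c c' x y. c x y + c' x y), smult = (\<lambda>a c x y. a * c x y)\<rparr>"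

definition H2 ::
    "complex^'d^'d \<Rightarrow> (complex, ('d free_alg set \<Rightarrow> 'd free_alg set \<Rightarrow> complex) set) module" where
  "H2 Q = quot_space (Z2_space Q) (B2 Q)"

definition defect_map ::
    "complex^'d^'d \<Rightarrow> ('d free_alg set \<Rightarrow> 'd free_alg set \<Rightarrow> complex) \<Rightarrow> complex^'d^'d" where
  "defect_map Q c =
    (let A = (\<lambda>j k. \<Sum>p\<in>UNIV. c (Au_star (Au_gen Q p j)) (Au_gen Q p k));
         B = (\<lambda>j k. \<Sum>p\<in>UNIV. Q $ j $ j / Q $ p $ p * c (Au_star (Au_gen Q j p)) (Au_gen Q k p))
     in \<chi> j k. if Q $ j $ j = Q $ k $ k then A j k - B k j else 0)"

definition defect_space :: "complex^'d^'d \<Rightarrow> (complex, complex^'d^'d) module" where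
  "defect_space Q = \<lparr>carrier = defect_map Q ` Z2 Q, mult = undefined, one = undefined,
     zero = 0, add = (+), smult = (\<lambda>a M. \<chi> j k. a * M $ j $ k)\<rparr>"


section \<open>Conditions on $Q$\<close>

definition diagonal_matrix :: "complex^'d^'d \<Rightarrow> bool" where
  "diagonal_matrix Q \<longleftrightarrow> (\<forall>j k. j \<noteq> k \<longrightarrow> Q $ j $ k = 0)"

text \<open>The order on \<^typ>\<open>complex\<close> is the one for which \<open>0 < z\<close> says that \<open>z\<close> is real and positive.\<close>

definition strictly_positive :: "complex^'d^'d \<Rightarrow> bool" where
  "strictly_positive Q \<longleftrightarrow>
    (\<forall>x. x \<noteq> 0 \<longrightarrow> 0 < (\<Sum>j\<in>UNIV. cnj (x $ j) * (Q *v x) $ j))"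

lemma strictly_positive_imp_invertible:
  assumes "strictly_positive Q"
  shows "invertible Q"
proof -
  have "x = 0" if "Q *v x = 0" for x
    using assms that unfolding strictly_positive_def by force
  then show ?thesis
    by (simp add: invertible_left_inverse matrix_left_invertible_ker)
qed

end

theory Submission
  imports Defs
begin

text \<open>The defect map is linear, so the claim is that its kernel on $Z^2$ is $B^2$; the isomorphism
  is then the one induced on the quotient (\<open>first_isomorphism_theorem\<close>).

  Write $A_u(Q) = F / I$ with $F$ the free algebra on the letters $u_{jk}, u_{jk}^*$. A cocycle $c$
  pulled back to $F$ is always a coboundary: prescribing a functional $\psi$ arbitrarily on the letters,
  the equation $\psi(fg) = \epsilon(f)\psi(g) + \psi(f)\epsilon(g) - c(f, g)$ extends it to words, and
  the cocycle identity makes the extension consistent (\<open>free_primitive_primitive_of\<close>).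
  So $c$ is a coboundary on $A_u(Q)$ iff the values on the letters can be chosen such that $\psi$
  vanishes on $I$. Because $c$ vanishes when one argument is in $I$, this only has to be checked on the
  relations (\<open>primitive_vanishes_on_rel_ideal\<close>).

  The relations say that $V W = 1 = W V$ for the two pairs $(u, u^*)$ and
  $(u^t, Q \bar u Q^{-1})$. On the entries of $V W - 1$ the functional $\psi$ has the values
  $\psi(V_{jk}) + \psi(W_{jk}) - \delta_{jk} \psi(1) - \sum_p c(V_{jp} \otimes W_{pk})$, and the
  cocycle identity for $V, W, V$ gives
  $\sum_p c(V_{jp} \otimes W_{pk}) = \sum_p c(W_{jp} \otimes V_{pk})$ (\<open>pairing_commute\<close>). Hence
  $V W - 1$ and $W V - 1$ impose the same condition, and $\psi$ vanishes on $I$ iff for all $j, k$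
  $$\psi(u_{jk}) + \psi(u_{kj}^*) = A_{jk} + \delta_{jk} \psi(1), \qquad
    \psi(u_{jk}) + \frac{Q_k}{Q_j} \psi(u_{kj}^*) = B_{kj} + \delta_{jk} \psi(1)$$
  with the matrices $A$, $B$ of the defect map (\<open>primitive_kills_rel_ideal_iff\<close>). These are
  separate systems of two equations in two unknowns, one for each $(j, k)$. If $Q_j \neq Q_k$ the
  system is regular; if $Q_j = Q_k$ both left-hand sides coincide, and it is solvable iff
  $A_{jk} = B_{kj}$. Solvability of all of them is exactly $\Delta(c) = 0$.\<close>

section \<open>Functionals and cocycles on the free algebra\<close>

lemma free_const_mult_single:
  "free_const a * Poly_Mapping.single w b = Poly_Mapping.single w (a * b)"
  by (simp add: free_const_def mult_single)

lemma free_const_commute: "free_const a * f = f * free_const a"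
proof (induction f rule: free_alg_induct)
  case (single w b)
  show ?case by (simp add: free_const_def mult_single mult.commute)
qed (simp add: algebra_simps)

lemma free_const_mult: "free_const a * free_const b = free_const (a * b)"
  by (simp add: free_const_def mult_single)

lemma free_const_1 [simp]: "free_const 1 = 1"
  by (simp add: free_const_def)

lemma free_const_minus_1:
  fixes f :: "'d free_alg"
  shows "free_const (- 1) * f = - f"
proof -
  have "free_const (- 1) + free_const 1 = (0 :: 'd free_alg)"
    unfolding free_const_def single_add[symmetric] by simp
  then have "(free_const (- 1) + free_const 1) * f = 0" by (simp only: mult_zero_left)
  then show ?thesis by (simp add: distrib_right eq_neg_iff_add_eq_0)
qed

lemma free_star_0: "free_star 0 = 0"
  by (simp add: free_star_def)

lemma free_star_1: "free_star 1 = 1"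
proof -
  have "free_star (Poly_Mapping.single 0 1) = Poly_Mapping.single 0 1"
    by (simp add: free_star_simps zero_list_def)
  then show ?thesis by simp
qed

lemma free_star_mult: "free_star (f * g) = free_star g * free_star f"
proof (induction f rule: free_alg_induct)
  case (single w a)
  show ?case
    by (induction g rule: free_alg_induct)
      (simp_all add: mult_single free_star_simps plus_list_def algebra_simps)
qed (simp add: free_star_simps algebra_simps)

lemma free_star_const: "free_star (free_const a) = free_const (cnj a)"
  by (simp add: free_const_def free_star_simps zero_list_def)

lemma free_star_diff: "free_star (f - g) = free_star f - free_star g"
  using free_star_simps(1)[of "f - g" g] by (simp add: algebra_simps)

lemma free_star_sum: "free_star (\<Sum>p\<in>S. F p) = (\<Sum>p\<in>S. free_star (F p))"
  by (induction S rule: infinite_finite_induct) (simp_all add: free_star_0 free_star_simps)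

lemma free_star_involutive:
  fixes f :: "'d free_alg"
  shows "free_star (free_star f) = f"
proof (induction f rule: free_alg_induct)
  case (single w a)
  have "letter_star (letter_star l) = l" for l :: "'d letter" by (cases l) auto
  then show ?case by (simp add: free_star_simps rev_map o_def)
qed (simp add: free_star_simps)

locale free_functional =
  fixes \<psi> :: "'d::finite free_alg \<Rightarrow> complex"
  assumes add: "\<psi> (f + g) = \<psi> f + \<psi> g"
    and scale: "\<psi> (free_const a * f) = a * \<psi> f"
begin

lemma zero: "\<psi> 0 = 0"
  using add[of 0 0] by simp

lemma diff: "\<psi> (f - g) = \<psi> f - \<psi> g"
  using add[of "f - g" g] by simp

lemma sum: "\<psi> (\<Sum>p\<in>S. F p) = (\<Sum>p\<in>S. \<psi> (F p))"
  by (induction S rule: infinite_finite_induct) (simp_all add: zero add)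

lemma single: "\<psi> (Poly_Mapping.single w a) = a * \<psi> (Poly_Mapping.single w 1)"
  using scale[of a "Poly_Mapping.single w 1"] by (simp add: free_const_mult_single)

end

interpretation free_eval: free_functional free_eval
  by unfold_locales (simp_all add: free_eval_add free_eval_mult free_eval_const)

locale free_cocycle =
  fixes c :: "'d::finite free_alg \<Rightarrow> 'd free_alg \<Rightarrow> complex"
  assumes functional_left: "free_functional (\<lambda>f. c f g)"
    and functional_right: "free_functional (c f)"
    and cocycle: "free_eval f * c g h - c (f * g) h + c f (g * h) - c f g * free_eval h = 0"
begin

sublocale left: free_functional "\<lambda>f. c f g" for g by (rule functional_left)
sublocale right: free_functional "c f" for f by (rule functional_right)

lemma one_left: "c 1 f = c 1 1 * free_eval f"
  using cocycle[of 1 1 f] by (simp add: free_eval_1)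

lemma one_right: "c f 1 = c 1 1 * free_eval f"
  using cocycle[of f 1 1] by (simp add: free_eval_1 mult.commute)

end

definition counital :: "('d::finite) free_alg^'d^'d \<Rightarrow> bool" where
  "counital V \<longleftrightarrow> (\<forall>j k. free_eval (V $ j $ k) = (if j = k then 1 else 0))"

definition pairing ::
    "('d free_alg \<Rightarrow> 'd free_alg \<Rightarrow> complex) \<Rightarrow>
      'd free_alg^'d^'d \<Rightarrow> ('d::finite) free_alg^'d^'d \<Rightarrow> complex^'d^'d" where
  "pairing c V W = (\<chi> j k. \<Sum>p\<in>UNIV. c (V $ j $ p) (W $ p $ k))"

text \<open>The sum over $p, q$ of the cocycle identity for $V_{jp}, W_{pq}, V_{qk}$: since $\epsilon(V) = 1$,
  the outer terms become the two pairings, and modulo \<open>I\<close> the middle ones become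
  $c(1, V_{jk})$ and $c(V_{jk}, 1)$, which are both $c(1, 1) \epsilon(V_{jk})$.\<close>

lemma (in free_cocycle) pairing_commute:
  fixes V W :: "'d free_alg^'d^'d"
  assumes V: "counital V"
    and null: "\<And>f g. f \<in> I \<Longrightarrow> c f g = 0" "\<And>f g. f \<in> I \<Longrightarrow> c g f = 0"
    and VW: "\<And>j k. (V ** W - mat 1) $ j $ k \<in> I" and WV: "\<And>j k. (W ** V - mat 1) $ j $ k \<in> I"
  shows "pairing c V W = pairing c W V"
proof -
  have "pairing c V W $ j $ k = pairing c W V $ j $ k" for j k
  proof -
    let ?s = "\<lambda>F. \<Sum>p\<in>UNIV. \<Sum>q\<in>UNIV. F p q :: complex"
    have "0 = ?s (\<lambda>p q. free_eval (V $ j $ p) * c (W $ p $ q) (V $ q $ k)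
        - c (V $ j $ p * W $ p $ q) (V $ q $ k) + c (V $ j $ p) (W $ p $ q * V $ q $ k)
        - c (V $ j $ p) (W $ p $ q) * free_eval (V $ q $ k))"
      by (simp add: cocycle)
    also have "\<dots> = (\<Sum>q\<in>UNIV. \<Sum>p\<in>UNIV. free_eval (V $ j $ p) * c (W $ p $ q) (V $ q $ k))
        - (\<Sum>q\<in>UNIV. \<Sum>p\<in>UNIV. c (V $ j $ p * W $ p $ q) (V $ q $ k))
        + ?s (\<lambda>p q. c (V $ j $ p) (W $ p $ q * V $ q $ k))
        - ?s (\<lambda>p q. c (V $ j $ p) (W $ p $ q) * free_eval (V $ q $ k))"
      unfolding sum.distrib sum_subtractf
      by (subst (4) sum.swap, subst (5) sum.swap) (rule refl)
    also have "(\<Sum>q\<in>UNIV. \<Sum>p\<in>UNIV. free_eval (V $ j $ p) * c (W $ p $ q) (V $ q $ k))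
        = (\<Sum>q\<in>UNIV. c (W $ j $ q) (V $ q $ k))"
      using V by (simp add: counital_def mult_delta_left mult_delta_right)
    also have "(\<Sum>q\<in>UNIV. \<Sum>p\<in>UNIV. c (V $ j $ p * W $ p $ q) (V $ q $ k)) = c 1 (V $ j $ k)"
    proof -
      have "(\<Sum>p\<in>UNIV. c (V $ j $ p * W $ p $ q) (V $ q $ k)) =
          (if j = q then 1 else 0) * c 1 (V $ q $ k)" for q
        using null(1)[OF VW[of j q], of "V $ q $ k"]
        by (auto simp: matrix_matrix_mult_def left.diff left.sum left.zero mat_def)
      then show ?thesis by (simp add: mult_delta_left mult_delta_right)
    qed
    also have "?s (\<lambda>p q. c (V $ j $ p) (W $ p $ q * V $ q $ k)) = c (V $ j $ k) 1"
    proof -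
      have "(\<Sum>q\<in>UNIV. c (V $ j $ p) (W $ p $ q * V $ q $ k)) =
          c (V $ j $ p) 1 * (if p = k then 1 else 0)" for p
        using null(2)[OF WV[of p k], of "V $ j $ p"]
        by (auto simp: matrix_matrix_mult_def right.diff right.sum right.zero mat_def)
      then show ?thesis by (simp add: mult_delta_left mult_delta_right)
    qed
    also have "?s (\<lambda>p q. c (V $ j $ p) (W $ p $ q) * free_eval (V $ q $ k))
        = (\<Sum>p\<in>UNIV. c (V $ j $ p) (W $ p $ k))"
      using V by (simp add: counital_def mult_delta_left mult_delta_right)
    finally show ?thesis
      using one_left[of "V $ j $ k"] one_right[of "V $ j $ k"] by (simp add: pairing_def)
  qed
  then show ?thesis by (simp add: vec_eq_iff)
qed

section \<open>Primitives on the free algebra\<close>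

text \<open>The equation \<open>mult\<close> says $\partial\psi = c$ on the free algebra.\<close>

locale free_primitive = free_functional \<psi> for \<psi> :: "'d::finite free_alg \<Rightarrow> complex" +
  fixes c :: "'d::finite free_alg \<Rightarrow> 'd free_alg \<Rightarrow> complex"
  assumes mult: "\<psi> (f * g) = free_eval f * \<psi> g + \<psi> f * free_eval g - c f g"
begin

text \<open>A relation $V W = 1$ becomes a linear equation for the values of $\psi$ on the entries, in which $c$
  contributes the inhomogeneous term.\<close>

lemma matrix_relation:
  assumes V: "counital V" and W: "counital W"
  shows "\<psi> ((V ** W - mat 1) $ j $ k) =
    \<psi> (V $ j $ k) + \<psi> (W $ j $ k) - (if j = k then \<psi> 1 else 0)
      - pairing c V W $ j $ k"
proof -
  have "\<psi> ((V ** W) $ j $ k) = (\<Sum>p\<in>UNIV. free_eval (V $ j $ p) * \<psi> (W $ p $ k)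
      + \<psi> (V $ j $ p) * free_eval (W $ p $ k) - c (V $ j $ p) (W $ p $ k))"
    by (simp add: matrix_matrix_mult_def sum mult)
  also have "\<dots> = \<psi> (W $ j $ k) + \<psi> (V $ j $ k) - (\<Sum>p\<in>UNIV. c (V $ j $ p) (W $ p $ k))"
    using V W by (simp add: counital_def sum.distrib sum_subtractf mult_delta_left mult_delta_right)
  finally show ?thesis by (simp add: diff mat_def zero pairing_def)
qed

end

text \<open>On the empty word, $\partial\psi(1, 1) = \psi(1)$ leaves only the value $c(1, 1)$; a nonempty word
  is split after its first letter. The values \<open>\<tau>\<close> on the letters are free parameters.\<close>

primrec word_primitive ::
    "('d free_alg \<Rightarrow> 'd free_alg \<Rightarrow> complex) \<Rightarrow> ('d letter \<Rightarrow> complex) \<Rightarrow> 'd letter list \<Rightarrow> complex"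
  where
  "word_primitive c \<tau> [] = c 1 1"
| "word_primitive c \<tau> (l # w) = letter_eval l * word_primitive c \<tau> w
     + \<tau> l * prod_list (map letter_eval w) - c (free_letter l) (Poly_Mapping.single w 1)"

definition primitive_of ::
    "('d free_alg \<Rightarrow> 'd free_alg \<Rightarrow> complex) \<Rightarrow> ('d letter \<Rightarrow> complex) \<Rightarrow> 'd free_alg \<Rightarrow> complex"
  where
  "primitive_of c \<tau> f =
    (\<Sum>w\<in>Poly_Mapping.keys f. Poly_Mapping.lookup f w * word_primitive c \<tau> w)"

lemma primitive_of_add: "primitive_of c \<tau> (f + g) = primitive_of c \<tau> f + primitive_of c \<tau> g"
  and primitive_of_single: "primitive_of c \<tau> (Poly_Mapping.single w a) = a * word_primitive c \<tau> w"
  unfolding primitive_of_def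
  by (rule free_sum_keys[where F="\<lambda>w a. a * word_primitive c \<tau> w"]; simp add: algebra_simps)+

context free_cocycle
begin

text \<open>The defining recursion splits off a single letter. The cocycle identity for $l, v, w$ is what
  carries the equation $\partial\psi = c$ from there to any splitting of a word.\<close>

lemma word_primitive_append:
  "word_primitive c \<tau> (v @ w) =
    prod_list (map letter_eval v) * word_primitive c \<tau> w
    + word_primitive c \<tau> v * prod_list (map letter_eval w)
    - c (Poly_Mapping.single v 1) (Poly_Mapping.single w 1)"
proof (induction v)
  case Nil
  have "Poly_Mapping.single [] 1 = (1 :: 'd free_alg)" by (simp flip: zero_list_def)
  then show ?case using one_left[of "Poly_Mapping.single w 1"] by (simp add: free_eval_single)
next
  case (Cons l v)
  have "free_letter l * Poly_Mapping.single v 1 = Poly_Mapping.single (l # v) 1"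
    "Poly_Mapping.single v 1 * Poly_Mapping.single w 1 = Poly_Mapping.single (v @ w) (1 :: complex)"
    by (simp_all add: free_letter_def mult_single plus_list_def)
  then have "c (free_letter l) (Poly_Mapping.single (v @ w) 1) =
      c (Poly_Mapping.single (l # v) 1) (Poly_Mapping.single w 1)
      + c (free_letter l) (Poly_Mapping.single v 1) * prod_list (map letter_eval w)
      - letter_eval l * c (Poly_Mapping.single v 1) (Poly_Mapping.single w 1)"
    using cocycle[of "free_letter l" "Poly_Mapping.single v 1" "Poly_Mapping.single w 1"]
    by (simp add: free_eval_single free_letter_def algebra_simps)
  then show ?case by (simp add: Cons algebra_simps)
qed

lemma free_primitive_primitive_of: "free_primitive (primitive_of c \<tau>) c"
proof unfold_locales
  fix f g :: "'d free_alg" and a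
  show "primitive_of c \<tau> (f + g) = primitive_of c \<tau> f + primitive_of c \<tau> g"
    by (rule primitive_of_add)
  show "primitive_of c \<tau> (free_const a * f) = a * primitive_of c \<tau> f"
    by (induction f rule: free_alg_induct)
      (simp_all add: free_const_mult_single primitive_of_single primitive_of_add algebra_simps)
  show "primitive_of c \<tau> (f * g) = free_eval f * primitive_of c \<tau> g
      + primitive_of c \<tau> f * free_eval g - c f g"
  proof (induction f rule: free_alg_induct)
    case (single v a)
    show ?case
    proof (induction g rule: free_alg_induct)
      case (single w b)
      show ?case
        using left.single[of v a "Poly_Mapping.single w b"]
          right.single[of "Poly_Mapping.single v 1" w b]
        by (simp add: word_primitive_append mult_single plus_list_def primitive_of_single
            free_eval_single algebra_simps)
    qed (simp add: distrib_left primitive_of_add free_eval_add right.add algebra_simps)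
  qed (simp add: distrib_right primitive_of_add free_eval_add left.add algebra_simps)
qed

lemma primitive_of_1: "primitive_of c \<tau> 1 = c 1 1"
  using primitive_of_single[of c \<tau> "[]" 1] by (simp add: zero_list_def flip: single_one)

lemma primitive_of_letter: "primitive_of c \<tau> (free_letter l) = \<tau> l"
proof -
  have "Poly_Mapping.single [] 1 = (1 :: 'd free_alg)" by (simp flip: zero_list_def)
  then show ?thesis
    using one_right[of "free_letter l"]
    by (simp add: free_letter_def primitive_of_single free_eval_single)
qed

end

section \<open>The defining relations as pairs of inverse matrices\<close>

definition u_conj :: "complex^'d^'d \<Rightarrow> 'd free_alg^'d^'d" where
  "u_conj Q = const_mat Q ** u_bar ** const_mat (matrix_inv Q)"

text \<open>The adjoint of $u$ is \<open>transpose u_bar\<close>; each pair is made mutually inverse by two of the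
  four relations.\<close>

definition inverse_pairs :: "complex^'d^'d \<Rightarrow> (('d free_alg^'d^'d) \<times> ('d free_alg^'d^'d)) set" where
  "inverse_pairs Q = {(u_mat, transpose u_bar), (transpose u_mat, u_conj Q)}"

lemma relation_mats_iff:
  "R \<in> relation_mats Q \<longleftrightarrow>
    (\<exists>(V, W)\<in>inverse_pairs Q. R = V ** W - mat 1 \<or> R = W ** V - mat 1)"
  by (auto simp: relation_mats_def inverse_pairs_def u_conj_def matrix_mul_assoc)

lemma relation_mats_subset_ideal: "R \<in> relation_mats Q \<Longrightarrow> R $ j $ k \<in> rel_ideal Q"
  unfolding rel_ideal_def by blast

lemma inverse_pairs_rel_ideal:
  assumes "(V, W) \<in> inverse_pairs Q"
  shows "(V ** W - mat 1) $ j $ k \<in> rel_ideal Q" and "(W ** V - mat 1) $ j $ k \<in> rel_ideal Q"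
  by (rule relation_mats_subset_ideal, use assms in \<open>unfold relation_mats_iff, blast\<close>)+

lemma rel_ideal_closed:
  "f \<in> rel_ideal Q \<Longrightarrow> g \<in> rel_ideal Q \<Longrightarrow> f + g \<in> rel_ideal Q"
  "f \<in> rel_ideal Q \<Longrightarrow> h * f \<in> rel_ideal Q"
  "f \<in> rel_ideal Q \<Longrightarrow> f * h \<in> rel_ideal Q"
  "f \<in> rel_ideal Q \<Longrightarrow> free_star f \<in> rel_ideal Q"
  "0 \<in> rel_ideal Q"
proof -
  interpret ideal "rel_ideal Q" Free by (rule ideal_rel_ideal)
  show "f \<in> rel_ideal Q \<Longrightarrow> h * f \<in> rel_ideal Q"
    using I_l_closed[of f h] by (simp add: Free_def)
  show "f \<in> rel_ideal Q \<Longrightarrow> g \<in> rel_ideal Q \<Longrightarrow> f + g \<in> rel_ideal Q"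
    using additive_subgroup.a_closed[OF is_additive_subgroup, of f g] by (simp add: Free_def)
  show "f \<in> rel_ideal Q \<Longrightarrow> f * h \<in> rel_ideal Q"
    using I_r_closed[of f h] by (simp add: Free_def)
  show "f \<in> rel_ideal Q \<Longrightarrow> free_star f \<in> rel_ideal Q"
    unfolding rel_ideal_def by blast
  show "0 \<in> rel_ideal Q"
    using additive_subgroup.zero_closed[OF is_additive_subgroup] by (simp add: Free_def)
qed

text \<open>Negation is multiplication by the scalar $-1$, so an ideal of an algebra is closed under it.\<close>

lemma idealI_Free:
  assumes "0 \<in> I" "\<And>f g. f \<in> I \<Longrightarrow> g \<in> I \<Longrightarrow> f + g \<in> I"
    and "\<And>f h. f \<in> I \<Longrightarrow> h * f \<in> I" "\<And>f h. f \<in> I \<Longrightarrow> f * h \<in> I"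
  shows "ideal I (Free :: (complex, 'd free_alg) module)"
proof -
  interpret ring "Free :: (complex, 'd free_alg) module" by (rule ring_Free)
  have "subgroup I (add_monoid Free)"
  proof (rule add.subgroupI)
    fix a assume "a \<in> I"
    moreover have "\<ominus>\<^bsub>Free\<^esub> a = - a"
      by (rule minus_equality) (simp_all add: Free_def)
    ultimately show "\<ominus>\<^bsub>Free\<^esub> a \<in> I"
      using assms(3)[of a "free_const (- 1)"] by (simp add: free_const_minus_1)
  qed (use assms in \<open>auto simp: Free_def\<close>)
  then show ?thesis
    using assms by (intro idealI ring_Free) (auto simp: Free_def)
qed

text \<open>The adjoint of an entry of one matrix is a multiple of the transposed entry of the other, with
  factors of the form $d_j / d_k$. These factors cancel along a matrix product, so that the adjoint
  of an entry of $V W - 1$ is a multiple of an entry of the same matrix.\<close>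

definition star_dual :: "('d \<Rightarrow> complex) \<Rightarrow> ('d::finite) free_alg^'d^'d \<Rightarrow> 'd free_alg^'d^'d \<Rightarrow> bool" where
  "star_dual d V W \<longleftrightarrow> (\<forall>j. d j \<noteq> 0) \<and>
    (\<forall>j k. free_star (V $ j $ k) = free_const (d j / d k) * W $ k $ j
         \<and> free_star (W $ j $ k) = free_const (d j / d k) * V $ k $ j)"

lemma star_dual_commute: "star_dual d V W \<Longrightarrow> star_dual d W V"
  by (simp add: star_dual_def)

lemma star_dual_relation:
  assumes "star_dual d V W"
  shows "free_star ((V ** W - mat 1) $ j $ k) = free_const (d j / d k) * (V ** W - mat 1) $ k $ j"
proof -
  have d: "d i \<noteq> 0" for i using assms by (simp add: star_dual_def)
  have "free_star ((V ** W) $ j $ k) = (\<Sum>p\<in>UNIV. free_star (W $ p $ k) * free_star (V $ j $ p))"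
    by (simp add: matrix_matrix_mult_def free_star_sum free_star_mult)
  also have "\<dots> = (\<Sum>p\<in>UNIV. free_const (d j / d k) * (V $ k $ p * W $ p $ j))"
  proof (rule sum.cong[OF refl])
    fix p
    have "free_star (W $ p $ k) * free_star (V $ j $ p) =
        free_const (d p / d k) * V $ k $ p * (free_const (d j / d p) * W $ p $ j)"
      using assms by (simp add: star_dual_def)
    also have "\<dots> = free_const (d p / d k) * (V $ k $ p * free_const (d j / d p)) * W $ p $ j"
      by (simp add: mult.assoc)
    also have "\<dots> = free_const (d p / d k) * free_const (d j / d p) * (V $ k $ p * W $ p $ j)"
      unfolding free_const_commute[of "d j / d p" "V $ k $ p", symmetric] by (simp only: mult.assoc)
    finally show "free_star (W $ p $ k) * free_star (V $ j $ p) =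
        free_const (d j / d k) * (V $ k $ p * W $ p $ j)"
      by (simp add: free_const_mult d)
  qed
  finally show ?thesis
    by (simp add: free_star_diff mat_def free_star_0 free_star_1 d sum_distrib_left algebra_simps
        matrix_matrix_mult_def)
qed

text \<open>On \<open>rel_ideal Q\<close> the counit $\epsilon$ vanishes, and so does \<open>c\<close> if one argument lies in it; hence
  $\psi(f h) = \psi(f) \epsilon(h)$ and $\psi(h f) = \epsilon(h) \psi(f)$ for $f$ in it: the kernel of
  $\psi$ on it is an ideal. The ideal
  generated by the relations is required to be closed under the star, which the kernel of $\psi$
  need not be. It is therefore compared with the intersection of this kernel and its adjoint;
  \<open>star_dual\<close> ensures that the relations belong to it.\<close>

lemma primitive_vanishes_on_rel_ideal:
  assumes prim: "free_primitive \<psi> c" and Q: "invertible Q"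
    and null: "\<And>f g. f \<in> rel_ideal Q \<Longrightarrow> c f g = 0" "\<And>f g. f \<in> rel_ideal Q \<Longrightarrow> c g f = 0"
    and dual: "\<And>V W. (V, W) \<in> inverse_pairs Q \<Longrightarrow> \<exists>d. star_dual d V W"
    and rel: "\<And>R j k. R \<in> relation_mats Q \<Longrightarrow> \<psi> (R $ j $ k) = 0"
    and f: "f \<in> rel_ideal Q"
  shows "\<psi> f = 0"
proof -
  interpret free_primitive \<psi> c by (rule prim)
  let ?K = "{f \<in> rel_ideal Q. \<psi> f = 0 \<and> \<psi> (free_star f) = 0}"
  note ev = free_eval_rel_ideal[OF Q]
  have "ideal ?K Free"
    by (rule idealI_Free)
      (auto simp: rel_ideal_closed zero free_star_0 add free_star_simps mult free_star_mult null ev)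
  moreover have "free_star ` ?K \<subseteq> ?K"
    by (auto simp: rel_ideal_closed free_star_involutive)
  moreover have "R $ j $ k \<in> ?K" if R: "R \<in> relation_mats Q" for R j k
  proof -
    obtain V W d where VW: "star_dual d V W" "R = V ** W - mat 1"
      using R dual star_dual_commute unfolding relation_mats_iff by blast
    then have "\<psi> (free_star (R $ j $ k)) = 0"
      using star_dual_relation[OF VW(1)] rel[OF R] by (simp add: scale)
    then show ?thesis using R by (simp add: rel relation_mats_subset_ideal)
  qed
  ultimately have "rel_ideal Q \<subseteq> ?K" unfolding rel_ideal_def by blast
  then show ?thesis using f by blast
qed

section \<open>The relations for a positive diagonal $Q$\<close>

lemma strictly_positive_diagonal_entry:
  assumes "strictly_positive Q"
  shows "0 < Q $ j $ j"
proof -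
  have column: "(Q *v axis j 1) $ i = Q $ i $ j" for i
    by (simp add: matrix_vector_mult_def axis_def mult_delta_right)
  have "(0::complex) < (\<Sum>i\<in>UNIV. cnj (axis j 1 $ i) * (Q *v axis j 1) $ i)"
    using assms unfolding strictly_positive_def by simp
  also have "\<dots> = Q $ j $ j"
    unfolding column by (simp add: axis_def if_distrib[of cnj] mult_delta_left cong: if_cong)
  finally show ?thesis .
qed

lemma strictly_positive_diagonal_simps:
  assumes "strictly_positive Q"
  shows "Q $ j $ j \<noteq> 0" and "cnj (Q $ j $ j) = Q $ j $ j"
  using strictly_positive_diagonal_entry[OF assms, of j] by (auto simp: less_complex_def complex_eq_iff)

lemma matrix_inv_diagonal:
  fixes Q :: "complex^'d^'d"
  assumes "diagonal_matrix Q" and "strictly_positive Q"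
  shows "matrix_inv Q $ j $ k = (if j = k then 1 / Q $ j $ j else 0)"
proof -
  have "Q ** matrix_inv Q = mat 1"
    using someI_ex[OF strictly_positive_imp_invertible[OF assms(2), unfolded invertible_def]]
    unfolding matrix_inv_def by blast
  then have "(Q ** matrix_inv Q) $ j $ k = mat 1 $ j $ k" by simp
  moreover have "(Q ** matrix_inv Q) $ j $ k =
      (\<Sum>p\<in>UNIV. if p = j then Q $ j $ j * matrix_inv Q $ j $ k else 0)"
    unfolding matrix_matrix_mult_def vec_lambda_beta
    by (rule sum.cong) (use assms(1) in \<open>auto simp: diagonal_matrix_def\<close>)
  ultimately show ?thesis
    using strictly_positive_diagonal_simps(1)[OF assms(2), of j]
    by (auto simp: mat_def field_simps split: if_splits)
qed

lemma u_entries: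
  "u_mat $ j $ k = free_letter (Gen j k)" "u_bar $ j $ k = free_letter (Gen_star j k)"
  by (simp_all add: u_mat_def u_bar_def free_letter_def free_star_simps)

lemma u_conj_entry:
  assumes "diagonal_matrix Q" and "strictly_positive Q"
  shows "u_conj Q $ j $ k = free_const (Q $ j $ j / Q $ k $ k) * free_letter (Gen_star j k)"
proof -
  have z: "free_const 0 = (0 :: 'd free_alg)" by (simp add: free_const_def)
  have "const_mat Q ** u_bar = (\<chi> j p. free_const (Q $ j $ j) * u_bar $ j $ p)"
  proof -
    have "(const_mat Q ** u_bar) $ j $ p =
        (\<Sum>i\<in>UNIV. if i = j then free_const (Q $ j $ j) * u_bar $ j $ p else 0)" for j p
      unfolding matrix_matrix_mult_def const_mat_def vec_lambda_beta
      by (rule sum.cong) (use assms(1) in \<open>auto simp: diagonal_matrix_def z\<close>)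
    then show ?thesis by (simp add: vec_eq_iff)
  qed
  then have "u_conj Q $ j $ k = (\<Sum>p\<in>UNIV.
      free_const (Q $ j $ j) * u_bar $ j $ p * const_mat (matrix_inv Q) $ p $ k)"
    by (simp add: u_conj_def matrix_matrix_mult_def[of _ "const_mat (matrix_inv Q)"])
  also have "\<dots> = (\<Sum>p\<in>UNIV. if p = k then
      free_const (Q $ j $ j) * u_bar $ j $ k * free_const (1 / Q $ k $ k) else 0)"
    by (rule sum.cong) (auto simp: const_mat_def matrix_inv_diagonal[OF assms] z)
  also have "\<dots> = free_const (1 / Q $ k $ k) * (free_const (Q $ j $ j) * u_bar $ j $ k)"
    by (simp flip: free_const_commute[of "1 / Q $ k $ k" "free_const (Q $ j $ j) * u_bar $ j $ k"])
  finally show ?thesis by (simp add: u_entries free_const_mult flip: mult.assoc)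
qed

lemma inverse_pairs_counital:
  assumes "diagonal_matrix Q" and "strictly_positive Q" and "(V, W) \<in> inverse_pairs Q"
  shows "counital V" and "counital W"
  using assms(3) strictly_positive_diagonal_simps(1)[OF assms(2)]
  by (auto simp: inverse_pairs_def counital_def u_entries transpose_def u_conj_entry[OF assms(1,2)]
      free_eval_mult free_eval_const free_letter_def free_eval_single)

text \<open>The weights are $d_j = 1$ for $(u, u^*)$ and $d_j = Q_j$ for $(u^t, Q \bar u Q^{-1})$. Here it
  matters that the $Q_j$ are real.\<close>

lemma inverse_pairs_star_dual:
  assumes "diagonal_matrix Q" and "strictly_positive Q" and "(V, W) \<in> inverse_pairs Q"
  shows "\<exists>d. star_dual d V W"
proof -
  have star: "free_star (free_letter l) = free_letter (letter_star l)" for l :: "'a letter"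
    by (simp add: free_letter_def free_star_simps)
  note Q = strictly_positive_diagonal_simps[OF assms(2)]
  have "star_dual (\<lambda>_. 1) u_mat (transpose (u_bar :: 'a free_alg^'a^'a))"
    by (simp add: star_dual_def u_entries transpose_def star)
  moreover have "star_dual (\<lambda>j. Q $ j $ j) (transpose u_mat) (u_conj Q)"
    by (simp add: star_dual_def u_entries transpose_def star u_conj_entry[OF assms(1,2)] Q
        free_star_mult free_star_const free_const_mult flip: mult.assoc)
      (simp add: free_const_commute)
  ultimately show ?thesis using assms(3) unfolding inverse_pairs_def by blast
qed

section \<open>Functionals and cocycles on $A_u(Q)$\<close>

lemma Au_class_eq_iff: "Au_class Q f = Au_class Q g \<longleftrightarrow> f - g \<in> rel_ideal Q"
proof -
  interpret ideal "rel_ideal Q" Free by (rule ideal_rel_ideal)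
  have mem: "f \<in> Au_class Q g \<longleftrightarrow> f - g \<in> rel_ideal Q" for f g
    by (auto simp: a_r_coset_def' Free_def intro!: bexI[of _ "f - g"])
  show ?thesis
    using Au_simps(7)[of f Q] a_repr_independence'[of f g] unfolding mem[symmetric]
    by (auto simp: Free_def)
qed

lemma linear_functionals_Au_iff:
  "\<psi> \<in> linear_functionals (Au Q) \<longleftrightarrow>
    free_functional (\<lambda>f. \<psi> (Au_class Q f)) \<and> (\<forall>X. X \<notin> carrier (Au Q) \<longrightarrow> \<psi> X = 0)"
  by (auto simp: linear_functionals_def free_functional_def Au_simps)

lemma free_functional_descends:
  assumes "free_functional \<psi>" and null: "\<And>f. f \<in> rel_ideal Q \<Longrightarrow> \<psi> f = 0"
  obtains \<psi>' where "\<psi>' \<in> linear_functionals (Au Q)" and "\<And>f. \<psi>' (Au_class Q f) = \<psi> f"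
proof
  interpret free_functional \<psi> by (rule assms)
  let ?\<psi>' = "\<lambda>X. if X \<in> carrier (Au Q) then \<psi> (SOME f. Au_class Q f = X) else 0"
  show cls: "?\<psi>' (Au_class Q f) = \<psi> f" for f
  proof -
    have "Au_class Q (SOME g. Au_class Q g = Au_class Q f) = Au_class Q f"
      by (rule someI) (rule refl)
    then have "\<psi> ((SOME g. Au_class Q g = Au_class Q f) - f) = 0"
      using null unfolding Au_class_eq_iff by blast
    then show ?thesis by (simp add: diff Au_simps(1))
  qed
  show "?\<psi>' \<in> linear_functionals (Au Q)"
    unfolding linear_functionals_Au_iff cls using assms(1) by simp
qed

text \<open>The functional induced by \<open>free_eval\<close> is a distinguished character, and there is only one.\<close>

lemma counit_Au_class:
  assumes "invertible Q"
  shows "counit Q (Au_class Q f) = free_eval f"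
proof -
  obtain e where e: "e \<in> linear_functionals (Au Q)" "\<And>f. e (Au_class Q f) = free_eval f"
    using free_functional_descends[OF free_eval.free_functional_axioms free_eval_rel_ideal[OF assms]]
    by blast
  have "is_distinguished_character Q e"
    unfolding is_distinguished_character_def
    by (auto simp: e Au_simps free_eval_mult free_eval_1 free_eval_star Au_gen_def u_mat_def
        free_letter_def free_eval_single)
  then have "counit Q = e"
    unfolding counit_def by (rule the1_equality[OF ex1_distinguished_character[OF assms]])
  then show ?thesis by (simp add: e)
qed

abbreviation Au_pullback ::
    "complex^'d^'d \<Rightarrow> ('d free_alg set \<Rightarrow> 'd free_alg set \<Rightarrow> complex) \<Rightarrow>
      'd free_alg \<Rightarrow> 'd free_alg \<Rightarrow> complex" where
  "Au_pullback Q c \<equiv> \<lambda>f g. c (Au_class Q f) (Au_class Q g)"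

lemma Z2_iff:
  assumes "invertible Q"
  shows "c \<in> Z2 Q \<longleftrightarrow> c \<in> bilinear_functionals (Au Q) \<and> free_cocycle (Au_pullback Q c)"
  by (auto simp: Z2_def free_cocycle_def Au_simps counit_Au_class[OF assms]
      bilinear_functionals_def linear_functionals_Au_iff)

lemma Au_pullback_rel_ideal:
  assumes "c \<in> bilinear_functionals (Au Q)" and "f \<in> rel_ideal Q"
  shows "Au_pullback Q c f g = 0" and "Au_pullback Q c g f = 0"
proof -
  have "Au_class Q f = Au_class Q 0" using assms(2) by (simp add: Au_class_eq_iff)
  moreover have "free_functional (\<lambda>f. Au_pullback Q c f g)" "free_functional (\<lambda>f. Au_pullback Q c g f)"
    using assms(1) by (auto simp: bilinear_functionals_def linear_functionals_Au_iff)
  ultimately show "Au_pullback Q c f g = 0" and "Au_pullback Q c g f = 0"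
    using free_functional.zero by metis+
qed

lemma coboundary_Au_class:
  assumes "invertible Q"
  shows "coboundary Q \<psi> (Au_class Q f) (Au_class Q g) =
    free_eval f * \<psi> (Au_class Q g) - \<psi> (Au_class Q (f * g)) + \<psi> (Au_class Q f) * free_eval g"
  by (simp add: coboundary_def Au_simps counit_Au_class[OF assms])

lemma coboundary_in_Z2:
  assumes Q: "invertible Q" and \<psi>: "\<psi> \<in> linear_functionals (Au Q)"
  shows "coboundary Q \<psi> \<in> Z2 Q"
proof -
  interpret free_functional "\<lambda>f. \<psi> (Au_class Q f)"
    using \<psi> by (simp add: linear_functionals_Au_iff)
  have comm: "f * (free_const a * g) = free_const a * (f * g)" for f g :: "'a free_alg" and a
    by (simp add: free_const_commute[of a g] free_const_commute[of a "f * g"] mult.assoc)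
  have functional: "free_functional (\<lambda>g. coboundary Q \<psi> X (Au_class Q g)) \<and>
      free_functional (\<lambda>g. coboundary Q \<psi> (Au_class Q g) X)" for X
  proof (cases "X \<in> carrier (Au Q)")
    case True
    then obtain f where "X = Au_class Q f" by (auto simp: Au_simps(1))
    then show ?thesis
      unfolding free_functional_def
      by (simp add: coboundary_Au_class[OF Q] add scale comm free_eval_add free_eval_mult
          free_eval_const mult.assoc algebra_simps)
  qed (simp add: coboundary_def free_functional_def)
  then have "coboundary Q \<psi> \<in> bilinear_functionals (Au Q)"
    by (simp add: bilinear_functionals_def linear_functionals_Au_iff coboundary_def)
  moreover have "free_cocycle (Au_pullback Q (coboundary Q \<psi>))"
    by (rule free_cocycle.intro)
      (simp_all only: functional, simp add: coboundary_Au_class[OF Q] free_eval_mult algebra_simps)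
  ultimately show ?thesis unfolding Z2_iff[OF Q] ..
qed

section \<open>Coboundaries are the cocycles without defect\<close>

locale diagonal_unitary_cocycle =
  fixes Q :: "complex^'d^'d" and c
  assumes diagonal: "diagonal_matrix Q" and positive: "strictly_positive Q"
    and cocycle_in_Z2: "c \<in> Z2 Q"
begin

lemma invertible: "invertible Q"
  by (rule strictly_positive_imp_invertible[OF positive])

lemma bilinear: "c \<in> bilinear_functionals (Au Q)"
  using cocycle_in_Z2 by (simp add: Z2_def)

sublocale free_cocycle "Au_pullback Q c"
  using cocycle_in_Z2 by (simp add: Z2_iff[OF invertible])

text \<open>The matrices $A$ and $B$ in the definition of the defect map.\<close>

abbreviation adj_pairing :: "complex^'d^'d" where
  "adj_pairing \<equiv> pairing (Au_pullback Q c) (transpose u_bar) u_mat"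

abbreviation conj_pairing :: "complex^'d^'d" where
  "conj_pairing \<equiv> pairing (Au_pullback Q c) (u_conj Q) (transpose u_mat)"

lemma defect_map_entry:
  "defect_map Q c $ j $ k =
    (if Q $ j $ j = Q $ k $ k then adj_pairing $ j $ k - conj_pairing $ k $ j else 0)"
proof -
  have "Au_star (Au_gen Q i l) = Au_class Q (free_letter (Gen_star i l))" for i l
    by (simp add: Au_gen_def u_entries Au_simps free_letter_def free_star_simps)
  then show ?thesis
    by (simp add: defect_map_def Let_def pairing_def transpose_def u_conj_entry[OF diagonal positive]
        left.scale u_entries Au_gen_def)
qed

text \<open>By \<open>pairing_commute\<close>, $\psi$ has the same values on $V W - 1$ and $W V - 1$ for each of the two
  inverse pairs. The equations are those for $W V - 1$; the second one is written at the entry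
  $(k, j)$, which makes both involve the same two letters.\<close>

lemma primitive_kills_rel_ideal_iff:
  assumes prim: "free_primitive \<psi> (Au_pullback Q c)"
  shows "(\<forall>f\<in>rel_ideal Q. \<psi> f = 0) \<longleftrightarrow>
    (\<forall>j k. \<psi> (free_letter (Gen j k)) + \<psi> (free_letter (Gen_star k j)) =
        adj_pairing $ j $ k + (if j = k then \<psi> 1 else 0)) \<and>
    (\<forall>j k. \<psi> (free_letter (Gen j k)) + Q $ k $ k / Q $ j $ j * \<psi> (free_letter (Gen_star k j)) =
        conj_pairing $ k $ j + (if j = k then \<psi> 1 else 0))"
proof -
  interpret prim: free_primitive \<psi> "Au_pullback Q c" by (rule prim)
  have "(\<forall>f\<in>rel_ideal Q. \<psi> f = 0) \<longleftrightarrow>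
      (\<forall>(V, W)\<in>inverse_pairs Q. \<forall>j k. \<psi> ((W ** V - mat 1) $ j $ k) = 0)"
  proof (intro iffI ballI)
    fix p assume null: "\<forall>f\<in>rel_ideal Q. \<psi> f = 0" and p: "p \<in> inverse_pairs Q"
    then show "case p of (V, W) \<Rightarrow> \<forall>j k. \<psi> ((W ** V - mat 1) $ j $ k) = 0"
      using inverse_pairs_rel_ideal(2) by blast
  next
    fix f assume WV: "\<forall>(V, W)\<in>inverse_pairs Q. \<forall>j k. \<psi> ((W ** V - mat 1) $ j $ k) = 0"
      and f: "f \<in> rel_ideal Q"
    have "\<psi> (R $ j $ k) = 0" if rel: "R \<in> relation_mats Q" for R j k
    proof -
      obtain V W where pair: "(V, W) \<in> inverse_pairs Q"
        and R: "R = V ** W - mat 1 \<or> R = W ** V - mat 1"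
        using rel unfolding relation_mats_iff by blast
      note counital = inverse_pairs_counital[OF diagonal positive pair]
      have "pairing (Au_pullback Q c) V W = pairing (Au_pullback Q c) W V"
        by (rule pairing_commute[OF counital(1) Au_pullback_rel_ideal[OF bilinear]
            inverse_pairs_rel_ideal[OF pair]])
      then have "\<psi> ((V ** W - mat 1) $ j $ k) = \<psi> ((W ** V - mat 1) $ j $ k)"
        by (simp only: prim.matrix_relation counital) simp
      then show ?thesis using WV pair R by fastforce
    qed
    then show "\<psi> f = 0"
      using primitive_vanishes_on_rel_ideal[OF prim invertible Au_pullback_rel_ideal[OF bilinear]
          inverse_pairs_star_dual[OF diagonal positive] _ f]
      by blast
  qed
  also have "\<dots> \<longleftrightarrow> (\<forall>j k. \<psi> ((transpose u_bar ** u_mat - mat 1) $ j $ k) = 0) \<and>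
      (\<forall>j k. \<psi> ((u_conj Q ** transpose u_mat - mat 1) $ k $ j) = 0)"
    by (auto simp: inverse_pairs_def)
  finally have kills: "(\<forall>f\<in>rel_ideal Q. \<psi> f = 0) \<longleftrightarrow>
      (\<forall>j k. \<psi> ((transpose u_bar ** u_mat - mat 1) $ j $ k) = 0) \<and>
      (\<forall>j k. \<psi> ((u_conj Q ** transpose u_mat - mat 1) $ k $ j) = 0)" .
  have left: "\<psi> ((transpose u_bar ** u_mat - mat 1) $ j $ k) =
      \<psi> (free_letter (Gen j k)) + \<psi> (free_letter (Gen_star k j)) -
        (adj_pairing $ j $ k + (if j = k then \<psi> 1 else 0))" for j k
    using inverse_pairs_counital[OF diagonal positive, of u_mat "transpose u_bar"]
    by (subst prim.matrix_relation) (auto simp: inverse_pairs_def transpose_def u_entries)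
  have right: "\<psi> ((u_conj Q ** transpose u_mat - mat 1) $ k $ j) =
      \<psi> (free_letter (Gen j k)) + Q $ k $ k / Q $ j $ j * \<psi> (free_letter (Gen_star k j)) -
        (conj_pairing $ k $ j + (if j = k then \<psi> 1 else 0))" for j k
    using inverse_pairs_counital[OF diagonal positive, of "transpose u_mat" "u_conj Q"]
    by (subst prim.matrix_relation)
      (auto simp: inverse_pairs_def transpose_def u_entries u_conj_entry[OF diagonal positive] prim.scale)
  show ?thesis unfolding kills left right by simp
qed

text \<open>A primitive of \<open>c\<close> on $A_u(Q)$ is the same as a primitive on the free algebra which solves the
  linear systems of \<open>primitive_kills_rel_ideal_iff\<close>.\<close>

lemma coboundary_iff_defect_0: "c \<in> B2 Q \<longleftrightarrow> defect_map Q c = 0"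
proof
  assume "c \<in> B2 Q"
  then obtain \<psi> where \<psi>: "\<psi> \<in> linear_functionals (Au Q)" "c = coboundary Q \<psi>"
    unfolding B2_def by blast
  let ?\<psi> = "\<lambda>f. \<psi> (Au_class Q f)"
  interpret \<psi>: free_functional ?\<psi>
    using \<psi> by (simp add: linear_functionals_Au_iff)
  have "free_primitive ?\<psi> (Au_pullback Q c)"
    by unfold_locales (simp add: \<psi>(2) coboundary_Au_class[OF invertible])
  moreover have "?\<psi> f = 0" if "f \<in> rel_ideal Q" for f
    using \<psi>.zero Au_class_eq_iff[of Q f 0] that by simp
  ultimately have
    "?\<psi> (free_letter (Gen j k)) + ?\<psi> (free_letter (Gen_star k j)) =
      adj_pairing $ j $ k + (if j = k then ?\<psi> 1 else 0)"
    "?\<psi> (free_letter (Gen j k)) + Q $ k $ k / Q $ j $ j * ?\<psi> (free_letter (Gen_star k j)) =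
      conj_pairing $ k $ j + (if j = k then ?\<psi> 1 else 0)" for j k
    using primitive_kills_rel_ideal_iff[of ?\<psi>] by blast+
  \<comment> \<open>For $Q_j = Q_k$ the two equations have the same left-hand side.\<close>
  then have "adj_pairing $ j $ k = conj_pairing $ k $ j" if "Q $ j $ j = Q $ k $ k" for j k
    using strictly_positive_diagonal_simps(1)[OF positive, of k] that
    by (metis add_right_cancel divide_self mult_1)
  then show "defect_map Q c = 0"
    by (simp add: vec_eq_iff defect_map_entry)
next
  assume "defect_map Q c = 0"
  then have defect: "adj_pairing $ j $ k = conj_pairing $ k $ j" if "Q $ j $ j = Q $ k $ k" for j k
    using defect_map_entry[of j k] that by simp
  \<comment> \<open>\<open>s k j\<close> is the value at $u_{kj}^*$: for $Q_j \neq Q_k$ it is found by subtracting the two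
    equations, and for $Q_j = Q_k$ any value will do. The first equation then gives the value at
    $u_{jk}$.\<close>
  define s where "s j k = (if Q $ j $ j = Q $ k $ k then 0
      else (conj_pairing $ j $ k - adj_pairing $ k $ j) / (Q $ j $ j / Q $ k $ k - 1))" for j k
  define \<tau> where "\<tau> l = (case l of
      Gen j k \<Rightarrow> adj_pairing $ j $ k + (if j = k then c (Au_class Q 1) (Au_class Q 1) else 0) - s k j
    | Gen_star j k \<Rightarrow> s j k)" for l
  let ?\<psi> = "primitive_of (Au_pullback Q c) \<tau>"
  interpret \<psi>: free_primitive ?\<psi> "Au_pullback Q c" by (rule free_primitive_primitive_of)
  have "adj_pairing $ j $ k + (Q $ k $ k / Q $ j $ j - 1) * s k j = conj_pairing $ k $ j" for j k
    using defect[of j k] strictly_positive_diagonal_simps(1)[OF positive, of j]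
    by (simp add: s_def)
  then have "\<forall>f\<in>rel_ideal Q. ?\<psi> f = 0"
    unfolding primitive_kills_rel_ideal_iff[OF \<psi>.free_primitive_axioms]
      primitive_of_letter primitive_of_1
    by (simp add: \<tau>_def algebra_simps)
  then obtain \<psi> where \<psi>: "\<psi> \<in> linear_functionals (Au Q)" "\<And>f. \<psi> (Au_class Q f) = ?\<psi> f"
    using free_functional_descends[OF \<psi>.free_functional_axioms] by blast
  have "coboundary Q \<psi> X Y = c X Y" for X Y
  proof (cases "X \<in> carrier (Au Q) \<and> Y \<in> carrier (Au Q)")
    case True
    then obtain f g where "X = Au_class Q f" "Y = Au_class Q g" by (auto simp: Au_simps(1))
    then show ?thesis by (simp add: coboundary_Au_class[OF invertible] \<psi> \<psi>.mult)
  next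
    case False
    then show ?thesis
      using bilinear by (auto simp: coboundary_def bilinear_functionals_def linear_functionals_def)
  qed
  then have "c = coboundary Q \<psi>" by (intro ext) simp
  then show "c \<in> B2 Q" using \<psi>(1) unfolding B2_def by blast
qed

end

section \<open>Passing to the quotient\<close>

text \<open>The hypothesis \<open>kernel\<close> says that \<open>L\<close> separates exactly the cosets of \<open>B\<close>, so evaluating \<open>L\<close> at
  any representative gives a well-defined bijection onto the image.\<close>

lemma first_isomorphism_theorem:
  fixes V :: "(complex, 'v) module" and W :: "(complex, 'w) module"
  assumes sub: "abelian_subgroup B V"
    and scale_closed: "\<And>a x. x \<in> carrier V \<Longrightarrow> a \<odot>\<^bsub>V\<^esub> x \<in> carrier V"
    and onto: "carrier W = L ` carrier V"
    and kernel: "\<And>x y. x \<in> carrier V \<Longrightarrow> y \<in> carrier V \<Longrightarrow> L x = L y \<longleftrightarrow> x \<ominus>\<^bsub>V\<^esub> y \<in> B"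
    and add: "\<And>x y. x \<in> carrier V \<Longrightarrow> y \<in> carrier V \<Longrightarrow> L (x \<oplus>\<^bsub>V\<^esub> y) = L x \<oplus>\<^bsub>W\<^esub> L y"
    and scale: "\<And>a x. x \<in> carrier V \<Longrightarrow> L (a \<odot>\<^bsub>V\<^esub> x) = a \<odot>\<^bsub>W\<^esub> L x"
  shows "\<exists>\<phi>. \<phi> \<in> vs_iso (quot_space V B) W"
proof -
  interpret abelian_subgroup B V by (rule sub)
  note defs = quot_space_def ring.extend_def FactRing_def module.fields_def monoid.extend_def
  let ?cls = "\<lambda>x. B +>\<^bsub>V\<^esub> x"
  have carrier: "carrier (quot_space V B) = ?cls ` carrier V"
    by (auto simp: defs A_RCOSETS_def')
  have mem: "y \<in> ?cls x \<longleftrightarrow> y \<in> carrier V \<and> L y = L x" if x: "x \<in> carrier V" for x y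
    using a_rcos_module[OF x, of y] a_elemrcos_carrier[OF x, of y]
    by (auto simp: kernel x a_minus_def)
  have cls_eq: "?cls x = ?cls y \<longleftrightarrow> L x = L y" if "x \<in> carrier V" "y \<in> carrier V" for x y
    unfolding set_eq_iff mem[OF that(1)] mem[OF that(2)] using that by metis
  define \<phi> where "\<phi> = (\<lambda>X. L (SOME x. x \<in> carrier V \<and> ?cls x = X))"
  have \<phi>: "\<phi> (?cls x) = L x" if x: "x \<in> carrier V" for x
  proof -
    have "(SOME y. y \<in> carrier V \<and> ?cls y = ?cls x) \<in> carrier V \<and>
        ?cls (SOME y. y \<in> carrier V \<and> ?cls y = ?cls x) = ?cls x"
      by (rule someI[of _ x]) (simp add: x)
    then show ?thesis using cls_eq x unfolding \<phi>_def by blast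
  qed
  have add_cls: "?cls x \<oplus>\<^bsub>quot_space V B\<^esub> ?cls y = ?cls (x \<oplus>\<^bsub>V\<^esub> y)"
    if "x \<in> carrier V" "y \<in> carrier V" for x y
    using a_rcos_sum[OF that] by (simp add: defs)
  have scale_cls: "a \<odot>\<^bsub>quot_space V B\<^esub> ?cls x = ?cls (a \<odot>\<^bsub>V\<^esub> x)" if x: "x \<in> carrier V" for a x
  proof -
    have "a \<odot>\<^bsub>quot_space V B\<^esub> ?cls x = (\<Union>y\<in>?cls x. ?cls (a \<odot>\<^bsub>V\<^esub> y))"
      by (simp add: defs)
    also have "\<dots> = (\<Union>y\<in>?cls x. ?cls (a \<odot>\<^bsub>V\<^esub> x))"
      by (rule SUP_cong) (auto simp: mem x cls_eq scale_closed scale)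
    also have "\<dots> = ?cls (a \<odot>\<^bsub>V\<^esub> x)"
      using a_rcos_self[OF x] by (subst UN_constant) auto
    finally show ?thesis .
  qed
  have "bij_betw \<phi> (carrier (quot_space V B)) (carrier W)"
    unfolding carrier onto by (auto simp: bij_betw_def inj_on_def \<phi> cls_eq image_image cong: image_cong)
  then have "\<phi> \<in> vs_iso (quot_space V B) W"
    unfolding vs_iso_def carrier
    by (auto simp: \<phi> add_cls scale_cls add scale scale_closed)
  then show ?thesis by blast
qed

lemma Z2_add:
  assumes "c \<in> Z2 Q" and "c' \<in> Z2 Q"
  shows "(\<lambda>x y. c x y + c' x y) \<in> Z2 Q"
  using assms unfolding Z2_def bilinear_functionals_def linear_functionals_def
  by (auto simp: algebra_simps)

lemma Z2_scale:
  assumes "c \<in> Z2 Q"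
  shows "(\<lambda>x y. a * c x y) \<in> Z2 Q"
proof -
  have "a * (counit Q x * c y z - c (x \<otimes>\<^bsub>Au Q\<^esub> y) z + c x (y \<otimes>\<^bsub>Au Q\<^esub> z) - c x y * counit Q z) = 0"
    if "x \<in> carrier (Au Q)" "y \<in> carrier (Au Q)" "z \<in> carrier (Au Q)" for x y z
    using assms that by (simp add: Z2_def)
  then show ?thesis
    using assms unfolding Z2_def bilinear_functionals_def linear_functionals_def
    by (auto simp: algebra_simps)
qed

lemma Z2_zero: "(\<lambda>x y. 0) \<in> Z2 Q"
  by (simp add: Z2_def bilinear_functionals_def linear_functionals_def)

lemma defect_map_add: "defect_map Q (\<lambda>x y. c x y + c' x y) = defect_map Q c + defect_map Q c'"
  by (simp add: defect_map_def Let_def vec_eq_iff sum.distrib algebra_simps)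

lemma defect_map_scale: "defect_map Q (\<lambda>x y. a * c x y) = (\<chi> j k. a * defect_map Q c $ j $ k)"
  by (simp add: defect_map_def Let_def vec_eq_iff sum_distrib_left algebra_simps)

lemma abelian_group_Z2_space: "abelian_group (Z2_space Q)"
proof (rule abelian_groupI)
  fix c assume "c \<in> carrier (Z2_space Q)"
  then show "\<exists>c'\<in>carrier (Z2_space Q). c' \<oplus>\<^bsub>Z2_space Q\<^esub> c = \<zero>\<^bsub>Z2_space Q\<^esub>"
    using Z2_scale[of c Q "- 1"]
    by (intro bexI[of _ "\<lambda>x y. - c x y"]) (simp_all add: Z2_space_def)
qed (auto simp: Z2_space_def Z2_add Z2_scale Z2_zero algebra_simps)

theorem corollary4p4:
  fixes Q :: "complex^'d^'d"
  assumes "diagonal_matrix Q" and "strictly_positive Q"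
  shows "\<exists>\<phi>. \<phi> \<in> vs_iso (H2 Q) (defect_space Q)"
  unfolding H2_def
proof (rule first_isomorphism_theorem)
  let ?V = "Z2_space Q"
  interpret abelian_group ?V by (rule abelian_group_Z2_space)
  note inv = strictly_positive_imp_invertible[OF assms(2)]
  have B2: "c \<in> B2 Q \<longleftrightarrow> c \<in> Z2 Q \<and> defect_map Q c = 0" for c
    using diagonal_unitary_cocycle.coboundary_iff_defect_0[OF diagonal_unitary_cocycle.intro[OF assms]]
      coboundary_in_Z2[OF inv] unfolding B2_def by blast
  have minus: "\<ominus>\<^bsub>?V\<^esub> c = (\<lambda>x y. (- 1) * c x y)" if "c \<in> Z2 Q" for c
    using that Z2_scale[OF that, of "- 1"]
    by (intro minus_equality) (simp_all add: Z2_space_def)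
  have "defect_map Q (\<lambda>x y. 0) = 0"
    using defect_map_scale[of Q 0 "\<lambda>x y. 0"] by (simp add: vec_eq_iff)
  then have zero: "(\<lambda>x y. 0) \<in> B2 Q"
    by (simp add: B2 Z2_zero)
  have "subgroup (B2 Q) (add_monoid ?V)"
  proof (rule add.subgroupI)
    fix c assume "c \<in> B2 Q"
    then show "\<ominus>\<^bsub>?V\<^esub> c \<in> B2 Q"
      using Z2_scale[of c Q "- 1"] defect_map_scale[of Q "- 1" c]
      unfolding B2 by (simp add: minus vec_eq_iff)
  next
    show "B2 Q \<noteq> {}" using zero by blast
  qed (auto simp: B2 Z2_space_def defect_map_add Z2_add Z2_scale)
  then show "abelian_subgroup (B2 Q) ?V"
    by (intro abelian_subgroupI3 additive_subgroup.intro abelian_group_Z2_space)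
  fix x y assume x: "x \<in> carrier ?V" and y: "y \<in> carrier ?V"
  then have Z: "x \<in> Z2 Q" "y \<in> Z2 Q" by (simp_all add: Z2_space_def)
  have "x \<ominus>\<^bsub>?V\<^esub> y = (\<lambda>u v. x u v + (- 1) * y u v)"
    using minus[OF Z(2)] by (simp add: a_minus_def Z2_space_def)
  then show "defect_map Q x = defect_map Q y \<longleftrightarrow> x \<ominus>\<^bsub>?V\<^esub> y \<in> B2 Q"
    unfolding B2 using Z Z2_add[OF Z(1) Z2_scale[OF Z(2), of "- 1"]]
    by (simp only: defect_map_add defect_map_scale) (simp add: vec_eq_iff)
qed (auto simp: Z2_space_def defect_space_def Z2_add Z2_scale defect_map_add defect_map_scale)

end
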